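(* Every graph $G$ with no vertices of degree $2$ or $4$ satisfies $\mathrm{Maj}'(G)\le 4$. That is, for every such $G$ there is an edge-coloring $c:E(G)\to\{1,2,3,4\}$ such that for every edge $uv\in E(G)$ and every color $i\in\{1,2,3,4\}$, $$\bigl|\{f\in E(G): |\{u,v\}\cap f|=1,\ c(f)=i\}\bigr|\le \frac{d(u)+d(v)}{2}-1 .$$
   Context: Graphs are finite and simple; $d(v)$ denotes the degree of the vertex $v$ in $G$. An edge-coloring is any map $c:E(G)\to C$ to a set $C$ of colors (not necessarily proper). It is a strong majority edge-coloring if for every edge $uv\in E(G)$ and every color $i\in C$, $$\bigl|\{f\in E(G): |\{u,v\}\cap f|=1,\ c(f)=i\}\bigr|\le \frac{d(u)+d(v)}{2}-1,$$ i.e. for every edge $e$ and every color $i$, at most half of the edges adjacent to $e$ (sharing exactly one endpoint with $e$) have color $i$. The least number of colors in a strong majority edge-coloring of $G$ is denoted $\mathrm{Maj}'(G)$. *)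

theory Defs
  imports Complex_Main "HOL-Library.FuncSet" "HOL-Library.Extended_Nat"
begin

definition finite_simple_graph :: "'a set \<Rightarrow> 'a set set \<Rightarrow> bool" where
  "finite_simple_graph V E \<longleftrightarrow> finite V \<and> (\<forall>e\<in>E. e \<subseteq> V \<and> card e = 2)"

definition degree :: "'a set set \<Rightarrow> 'a \<Rightarrow> nat" where
  "degree E v = card {e \<in> E. v \<in> e}"

definition strong_majority_edge_coloring ::
    "'a set set \<Rightarrow> 'c set \<Rightarrow> ('a set \<Rightarrow> 'c) \<Rightarrow> bool" where
  "strong_majority_edge_coloring E C c \<longleftrightarrow>
     c \<in> E \<rightarrow> C \<and>
     (\<forall>u v. {u, v} \<in> E \<longrightarrow>
       (\<forall>i\<in>C. real (card {f \<in> E. card ({u, v} \<inter> f) = 1 \<and> c f = i})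
                 \<le> (real (degree E u) + real (degree E v)) / 2 - 1))"

text \<open>The index takes values in the extended naturals because some graphs
  (for instance the path with two edges) have no strong majority edge-coloring;
  for these the infimum is taken over the empty set and equals \<open>\<infinity>\<close>.\<close>

definition Maj' :: "'a set set \<Rightarrow> enat" where
  "Maj' E = (INF k \<in> {k :: nat. \<exists>c :: 'a set \<Rightarrow> nat.
                strong_majority_edge_coloring E {1..k} c}. enat k)"

end

theory Submission
  imports Defs "HOL-Combinatorics.Transposition"
begin

text \<open>Split every vertex of degree \<open>d\<close> into \<open>\<lceil>d/3\<rceil>\<close> vertices of degree at most 3. The resulting
  simple graph is subcubic, so by Vizing's theorem it has a proper edge-coloring with 4 colors;
  for maximum degree 3 one Kempe swap suffices: an uncolored edge \<open>uv\<close> and a neighbor \<open>x\<close> of \<open>u\<close>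
  give three ends of two-colored chains, and no chain has three ends. Pulled back to the original
  graph, each color occurs at most \<open>\<lceil>d/3\<rceil>\<close> times at a vertex of degree \<open>d\<close>, and
  \<open>\<lceil>d/3\<rceil> \<le> (d - 1)/2\<close> for all \<open>d \<ge> 3\<close> except \<open>d = 4\<close>.\<close>

section \<open>Proper edge-colorings and Kempe swaps\<close>

definition proper_edge_coloring :: "'a set set \<Rightarrow> 'c set \<Rightarrow> ('a set \<Rightarrow> 'c) \<Rightarrow> bool" where
  "proper_edge_coloring E C c \<longleftrightarrow>
     c \<in> E \<rightarrow> C \<and> (\<forall>e\<in>E. \<forall>f\<in>E. \<forall>w. w \<in> e \<longrightarrow> w \<in> f \<longrightarrow> c e = c f \<longrightarrow> e = f)"

definition missing :: "'a set set \<Rightarrow> 'c set \<Rightarrow> ('a set \<Rightarrow> 'c) \<Rightarrow> 'a \<Rightarrow> 'c set" where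
  "missing E C c w = C - c ` {e \<in> E. w \<in> e}"

lemma missing_iff: "i \<in> missing E C c w \<longleftrightarrow> i \<in> C \<and> (\<forall>f\<in>E. w \<in> f \<longrightarrow> c f \<noteq> i)"
  by (auto simp: missing_def)

definition adj_rel :: "'a set set \<Rightarrow> ('a \<times> 'a) set" where
  "adj_rel F = {(p, q). {p, q} \<in> F}"

lemma rtrancl_adj_rel_edge:
  assumes "(x, z) \<in> (adj_rel F)\<^sup>*" "x \<noteq> z"
  obtains y where "{x, y} \<in> F"
  using assms by (cases rule: converse_rtranclE) (auto simp: adj_rel_def)

lemma degree_mono:
  assumes "finite E" "F \<subseteq> E"
  shows "degree F v \<le> degree E v"
  unfolding degree_def using assms by (intro card_mono) auto

lemma degree_remove:
  assumes "finite E" "e \<in> E" "v \<in> e"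
  shows "degree E v = Suc (degree (E - {e}) v)"
proof -
  have "{f \<in> E. v \<in> f} = insert e {f \<in> E - {e}. v \<in> f}" using assms by auto
  then show ?thesis unfolding degree_def using assms by simp
qed

lemma degree_le_1_unique:
  assumes "finite E" "degree E v \<le> 1" "e \<in> E" "f \<in> E" "v \<in> e" "v \<in> f"
  shows "e = f"
proof (rule ccontr)
  assume "e \<noteq> f"
  then have "card {e, f} = 2" by simp
  moreover have "card {e, f} \<le> degree E v"
    unfolding degree_def using assms by (intro card_mono) auto
  ultimately show False using assms(2) by simp
qed

text \<open>Components of a graph with maximum degree 2 are paths or cycles, and a path has only two
  ends. The induction shortens the path: the only edge at \<open>x\<close> is deleted and its other
  endpoint \<open>y\<close> takes over the role of \<open>x\<close>.\<close>

lemma three_ends_not_connected: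
  assumes "finite F" "\<And>e. e \<in> F \<Longrightarrow> card e = 2" "\<And>w. degree F w \<le> 2"
    and "x \<noteq> u" "x \<noteq> v" "u \<noteq> v"
    and "degree F x \<le> 1" "degree F u \<le> 1" "degree F v \<le> 1"
    and "(x, u) \<in> (adj_rel F)\<^sup>*" "(x, v) \<in> (adj_rel F)\<^sup>*"
  shows False
  using assms
proof (induction "card F" arbitrary: F x rule: less_induct)
  case less
  have fin: "finite F" by fact
  obtain y where xy: "{x, y} \<in> F"
    using rtrancl_adj_rel_edge \<open>(x, u) \<in> _\<close> \<open>x \<noteq> u\<close> by metis
  have "x \<noteq> y" using less.prems(2)[OF xy] by auto
  let ?F = "F - {{x, y}}"
  have uniq: "e = {x, y}" if "e \<in> F" "x \<in> e" for e
    using degree_le_1_unique[OF fin less.prems(7) that(1) xy that(2)] by simp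
  \<comment> \<open>Since \<open>{x, y}\<close> is the only edge at \<open>x\<close>, a walk that
    returns to \<open>x\<close> starts afresh through \<open>y\<close>, so whatever is reached
    beyond \<open>x\<close> is reached from \<open>y\<close> without this edge.\<close>
  have reach: "z = x \<or> (y, z) \<in> (adj_rel ?F)\<^sup>*" if "(x, z) \<in> (adj_rel F)\<^sup>*" for z
    using that
  proof (induction rule: rtrancl_induct)
    case (step z w)
    have zw: "{z, w} \<in> F" using step(2) by (simp add: adj_rel_def)
    show ?case
    proof (cases "z = x \<or> w = x")
      case True
      then show ?thesis using uniq[OF zw] \<open>x \<noteq> y\<close> by (auto simp: doubleton_eq_iff)
    next
      case False
      then have "(z, w) \<in> adj_rel ?F" using zw by (auto simp: adj_rel_def doubleton_eq_iff)
      then show ?thesis using step(3) False by (meson rtrancl.rtrancl_into_rtrancl)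
    qed
  qed simp
  have yu: "(y, u) \<in> (adj_rel ?F)\<^sup>*" and yv: "(y, v) \<in> (adj_rel ?F)\<^sup>*"
    using reach less.prems by auto
  \<comment> \<open>If \<open>y\<close> were one of the ends \<open>u\<close>, \<open>v\<close>,
    then deleting \<open>{x, y}\<close> would isolate it, and it could not reach the other
    end.\<close>
  have iso: "y \<noteq> w" if "degree F w \<le> 1" "(y, w') \<in> (adj_rel ?F)\<^sup>*" "w \<noteq> w'" for w w'
  proof
    assume "y = w"
    with that obtain z where "{y, z} \<in> ?F"
      using rtrancl_adj_rel_edge[of y w' ?F] by metis
    then show False
      using degree_le_1_unique[OF fin that(1), of "{y, z}" "{x, y}"] xy \<open>y = w\<close> by auto
  qed
  have "y \<noteq> u" "y \<noteq> v" using iso yu yv less.prems by metis+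
  moreover have "degree ?F y \<le> 1"
    using degree_remove[OF fin xy, of y] less.prems(3)[of y] by simp
  moreover have "degree ?F w \<le> degree F w" for w using degree_mono[OF fin] by blast
  moreover have "card ?F < card F" using fin xy by (rule card_Diff1_less)
  ultimately show False
    using less.hyps[of ?F y, OF _ _ _ _ _ _ less.prems(6) _ _ _ yu yv] fin less.prems
    by (meson DiffD1 finite_Diff le_trans)
qed

lemma degree_le_card_colors:
  assumes "finite E" "proper_edge_coloring E C c"
    and F: "F \<subseteq> E" "finite D" "c ` {e \<in> F. w \<in> e} \<subseteq> D"
  shows "degree F w \<le> card D"
proof -
  have "inj_on c {e \<in> F. w \<in> e}"
    using assms(2) F(1) unfolding proper_edge_coloring_def inj_on_def by blast
  then show ?thesis unfolding degree_def using F by (metis card_inj_on_le)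
qed

text \<open>\<open>K\<close> is the vertex set of the component of \<open>x\<close> among the edges
  colored \<open>a\<close> or \<open>b\<close>. A vertex missing one of these colors has degree at
  most 1 there, so \<open>u\<close> and \<open>v\<close> cannot both join \<open>x\<close> in
  \<open>K\<close>. The new color of an edge can be read off at either of its endpoints.\<close>

lemma kempe_swap:
  assumes "finite E" "\<And>e. e \<in> E \<Longrightarrow> card e = 2" "proper_edge_coloring E C c"
    and "x \<noteq> u" "x \<noteq> v" "u \<noteq> v" "a \<in> C" "b \<in> C" "a \<noteq> b"
    and ends: "\<And>w. w \<in> {x, u, v} \<Longrightarrow> a \<in> missing E C c w \<or> b \<in> missing E C c w"
  obtains K c' where "x \<in> K" "\<not> (u \<in> K \<and> v \<in> K)" "proper_edge_coloring E C c'"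
    "\<And>e w. e \<in> E \<Longrightarrow> w \<in> e \<Longrightarrow> c' e = (if w \<in> K then transpose a b (c e) else c e)"
proof -
  define F where "F = {e \<in> E. c e \<in> {a, b}}"
  define K where "K = {z. (x, z) \<in> (adj_rel F)\<^sup>*}"
  \<comment> \<open>All edges that meet \<open>K\<close> are treated alike, because the
    transposition fixes every color other than \<open>a\<close> and \<open>b\<close>.\<close>
  define c' where "c' e = (if e \<inter> K \<noteq> {} then transpose a b (c e) else c e)" for e
  have F: "F \<subseteq> E" "finite F" using assms(1) by (auto simp: F_def)
  have "degree F w \<le> card {a, b}" for w
    by (rule degree_le_card_colors[OF assms(1,3) F(1)]) (auto simp: F_def)
  then have deg2: "degree F w \<le> 2" for w using \<open>a \<noteq> b\<close> by (metis card_2_iff)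
  have deg1: "degree F w \<le> 1" if w: "w \<in> {x, u, v}" for w
  proof -
    have "c ` {e \<in> F. w \<in> e} \<subseteq> {b} \<or> c ` {e \<in> F. w \<in> e} \<subseteq> {a}"
      using ends[OF w] by (auto simp: F_def missing_iff)
    then obtain i where "c ` {e \<in> F. w \<in> e} \<subseteq> {i}" by blast
    then show ?thesis using degree_le_card_colors[OF assms(1,3) F(1), of "{i}" w] by simp
  qed
  have nuv: "\<not> (u \<in> K \<and> v \<in> K)"
  proof
    assume "u \<in> K \<and> v \<in> K"
    then show False
      using three_ends_not_connected[OF F(2) _ deg2 assms(4-6)] assms(2) F(1) deg1
      unfolding K_def by blast
  qed
  have c': "c' e = (if w \<in> K then transpose a b (c e) else c e)" if "e \<in> E" "w \<in> e" for e w
  proof (cases "c e \<in> {a, b} \<and> e \<inter> K \<noteq> {}")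
    case True
    then obtain z where z: "z \<in> e" "z \<in> K" by auto
    \<comment> \<open>An edge colored \<open>a\<close> or \<open>b\<close> that meets
      \<open>K\<close> lies inside \<open>K\<close>, hence its endpoints agree on whether to
      swap.\<close>
    have "w \<in> K"
    proof (cases "z = w")
      case False
      then have "e = {z, w}" using assms(2)[OF that(1)] that(2) z(1)
        by (auto simp: card_2_iff)
      then have "(z, w) \<in> adj_rel F" using True that by (simp add: adj_rel_def F_def)
      then show ?thesis using z by (simp add: K_def)
    qed (use z in simp)
    then show ?thesis using that by (auto simp: c'_def)
  next
    case False
    then show ?thesis using that by (auto simp: c'_def transpose_def)
  qed
  have "proper_edge_coloring E C c'"
    unfolding proper_edge_coloring_def
  proof (intro conjI ballI allI impI)
    show "c' \<in> E \<rightarrow> C"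
      using assms(3,7,8) by (auto simp: proper_edge_coloring_def c'_def transpose_def)
    show "e = f" if "e \<in> E" "f \<in> E" "w \<in> e" "w \<in> f" "c' e = c' f" for e f w
    proof -
      have "c e = c f" using that c' by (auto split: if_splits dest: transpose_eq_imp_eq)
      then show ?thesis using assms(3) that unfolding proper_edge_coloring_def by blast
    qed
  qed
  moreover have "x \<in> K" by (simp add: K_def)
  ultimately show thesis using that nuv c' by blast
qed

section \<open>Subcubic graphs\<close>

lemma card_missing_ge:
  assumes "finite E" "finite C"
  shows "card C \<le> card (missing E C c w) + degree E w"
proof -
  have "card (c ` {e \<in> E. w \<in> e}) \<le> degree E w"
    unfolding degree_def using assms by (intro card_image_le) auto
  moreover have "card C - card (c ` {e \<in> E. w \<in> e}) \<le> card (missing E C c w)"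
    unfolding missing_def using assms by (intro diff_card_le_card_Diff) auto
  ultimately show ?thesis by linarith
qed

text \<open>The edge \<open>e\<close> may already belong to \<open>E\<close>, so this covers
  recoloring an edge as well as adding one.\<close>

lemma proper_edge_coloring_upd:
  assumes c: "proper_edge_coloring E C c" and "i \<in> C"
    and i: "\<And>w f. w \<in> e \<Longrightarrow> f \<in> E \<Longrightarrow> w \<in> f \<Longrightarrow> f \<noteq> e \<Longrightarrow> c f \<noteq> i"
  shows "proper_edge_coloring (insert e E) C (c(e := i))"
  unfolding proper_edge_coloring_def
proof (intro conjI ballI allI impI)
  show "c(e := i) \<in> insert e E \<rightarrow> C"
    using c \<open>i \<in> C\<close> by (auto simp: proper_edge_coloring_def)
  fix f g w
  assume fg: "f \<in> insert e E" "g \<in> insert e E" "w \<in> f" "w \<in> g" "(c(e := i)) f = (c(e := i)) g"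
  show "f = g"
  proof (cases "f = e \<or> g = e")
    case True
    then show ?thesis using fg i by (metis fun_upd_apply insertE)
  next
    case False
    then show ?thesis using fg c unfolding proper_edge_coloring_def by auto
  qed
qed

lemma extend_common_missing:
  assumes "proper_edge_coloring E C c" "i \<in> missing E C c u" "i \<in> missing E C c v"
  shows "proper_edge_coloring (insert {u, v} E) C (c({u, v} := i))"
  using assms by (intro proper_edge_coloring_upd) (auto simp: missing_iff)

text \<open>A fan rotation of length one: recoloring \<open>{u, x}\<close> with \<open>m\<close>
  frees its old color at \<open>u\<close>, and \<open>v\<close> misses that color too, so
  \<open>{u, v}\<close> can take it.\<close>

lemma extend_shift:
  assumes c: "proper_edge_coloring E C c" and ux: "{u, x} \<in> E" and "v \<noteq> x" "u \<noteq> v"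
    and m: "m \<in> missing E C c u" "m \<in> missing E C c x"
    and b: "c {u, x} \<in> missing E C c v"
  shows "proper_edge_coloring (insert {u, v} E) C (c({u, x} := m, {u, v} := c {u, x}))"
proof (rule extend_common_missing)
  let ?c = "c({u, x} := m)"
  show "proper_edge_coloring E C ?c"
    using extend_common_missing[OF c m] ux by (simp add: insert_absorb)
  have "?c f \<noteq> c {u, x}" if f: "f \<in> E" "u \<in> f" for f
  proof (cases "f = {u, x}")
    case True
    then show ?thesis using m(1) ux by (auto simp: missing_iff)
  next
    case False
    then have "c f \<noteq> c {u, x}"
      using c f ux unfolding proper_edge_coloring_def by blast
    then show ?thesis using False by simp
  qed
  then show "c {u, x} \<in> missing E C ?c u" using b by (simp add: missing_iff)
  show "c {u, x} \<in> missing E C ?c v"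
    using b \<open>v \<noteq> x\<close> \<open>u \<noteq> v\<close> by (auto simp: missing_iff)
qed

text \<open>Degrees are counted before \<open>{u, v}\<close> is added, so \<open>u\<close> and
  \<open>v\<close> each miss at least two of the four colors. If they share no missing color, a
  shift along an edge \<open>{u, x}\<close> or one Kempe swap started at \<open>x\<close> makes
  room.\<close>

lemma extend_subcubic_coloring:
  assumes "finite E" and card2: "\<And>e. e \<in> E \<Longrightarrow> card e = 2" and C: "card C = 4"
    and c: "proper_edge_coloring E C c"
    and uv: "u \<noteq> v" "{u, v} \<notin> E" "degree E u \<le> 2" "degree E v \<le> 2"
    and deg3: "\<And>w. degree E w \<le> 3"
  shows "\<exists>c'. proper_edge_coloring (insert {u, v} E) C c'"
proof (cases "missing E C c u \<inter> missing E C c v = {}")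
  case False
  then show ?thesis using extend_common_missing[OF c] by blast
next
  case disj: True
  let ?M = "missing E C c"
  have finC: "finite C" using C by (simp add: card_ge_0_finite)
  have sub: "?M w \<subseteq> C" for w by (auto simp: missing_def)
  have fin: "finite (?M w)" for w using sub finC finite_subset by blast
  have ge: "2 \<le> card (?M u)" "2 \<le> card (?M v)"
    using card_missing_ge[OF \<open>finite E\<close> finC, of c u] card_missing_ge[OF \<open>finite E\<close> finC, of c v]
      C uv by linarith+
  \<comment> \<open>Two disjoint sets of at least two colors each exhaust the four colors, so every
    color is missing at \<open>u\<close> or at \<open>v\<close>.\<close>
  then have "card (?M u \<union> ?M v) \<ge> card C" using C disj fin by (simp add: card_Un_disjoint)
  then have un: "?M u \<union> ?M v = C"
    using card_seteq[OF finC] sub by (metis Un_least)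
  have nonempty: "?M w \<noteq> {}" for w
    using card_missing_ge[OF \<open>finite E\<close> finC, of c w] C deg3[of w] by auto
  \<comment> \<open>The edge at \<open>u\<close> that carries a color missing at \<open>v\<close> is
    the candidate for the shift.\<close>
  obtain b where b: "b \<in> ?M v" using nonempty by blast
  then have "b \<notin> ?M u" "b \<in> C" using disj sub by auto
  then obtain e where e: "e \<in> E" "u \<in> e" "c e = b" by (auto simp: missing_def)
  then obtain x where x: "e = {u, x}" "x \<noteq> u"
    using card2[OF e(1)] by (auto simp: card_2_iff)
  have ux: "{u, x} \<in> E" and cux: "c {u, x} = b" using e x by auto
  then have "x \<noteq> v" using uv(2) by auto
  obtain m where m: "m \<in> ?M x" using nonempty by blast
  show ?thesis
  proof (cases "m \<in> ?M u")
    case True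
    then show ?thesis
      using extend_shift[OF c ux _ uv(1) True m] cux b \<open>x \<noteq> v\<close> by auto
  next
    case False
    then have mv: "m \<in> ?M v" using m sub un by blast
    have "m \<noteq> b" using m e x by (auto simp: missing_def)
    \<comment> \<open>Now \<open>u\<close> misses \<open>a\<close>, while \<open>v\<close> and
      \<open>x\<close> miss \<open>m\<close>: all three are ends of chains colored \<open>a\<close>
      and \<open>m\<close>.\<close>
    obtain a where a: "a \<in> ?M u" using nonempty by blast
    have ne: "a \<noteq> m" "a \<noteq> b" using a mv b disj by auto
    have "a \<in> C" "m \<in> C" using a m sub by auto
    obtain K c' where K: "x \<in> K" "\<not> (u \<in> K \<and> v \<in> K)" "proper_edge_coloring E C c'"
      and c': "\<And>e w. e \<in> E \<Longrightarrow> w \<in> e \<Longrightarrow> c' e = (if w \<in> K then transpose a m (c e) else c e)"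
      by (rule kempe_swap[OF \<open>finite E\<close> card2 c \<open>x \<noteq> u\<close> \<open>x \<noteq> v\<close> uv(1) \<open>a \<in> C\<close> \<open>m \<in> C\<close> ne(1)])
        (use a m mv in \<open>blast+\<close>)
    have swapped: "transpose a m i \<in> missing E C c' w" if "w \<in> K" "i \<in> ?M w" for w i
      unfolding missing_iff
    proof (intro conjI ballI impI)
      show "transpose a m i \<in> C"
        using that(2) \<open>a \<in> C\<close> \<open>m \<in> C\<close> by (auto simp: missing_iff transpose_def)
      fix f assume "f \<in> E" "w \<in> f"
      then show "c' f \<noteq> transpose a m i" using c' that by (auto simp: missing_iff dest: transpose_eq_imp_eq)
    qed
    have kept: "i \<in> missing E C c' w" if "w \<notin> K" "i \<in> ?M w" for w i
      using that c' by (simp add: missing_iff)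
    \<comment> \<open>If exactly one of \<open>u\<close> and \<open>v\<close> is swapped, they come
      to share the missing color \<open>m\<close> or \<open>a\<close>. If neither is,
      \<open>x\<close> now misses \<open>a\<close> as \<open>u\<close> does, and the shift applies
      because \<open>{u, x}\<close> keeps color \<open>b\<close>.\<close>
    consider "u \<in> K" "v \<notin> K" | "u \<notin> K" "v \<in> K" | "u \<notin> K" "v \<notin> K" using K(2) by blast
    then show ?thesis
    proof cases
      case 1
      have "m \<in> missing E C c' u" using swapped[OF 1(1) a] by simp
      then show ?thesis using extend_common_missing[OF K(3)] kept[OF 1(2) mv] by blast
    next
      case 2
      have "a \<in> missing E C c' v" using swapped[OF 2(2) mv] by simp
      then show ?thesis using extend_common_missing[OF K(3)] kept[OF 2(1) a] by blast
    next
      case 3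
      have "a \<in> missing E C c' x" using swapped[OF K(1) m] by simp
      moreover have "c' {u, x} = b" using c'[OF ux, of u] cux ne \<open>m \<noteq> b\<close> 3 by simp
      ultimately show ?thesis
        using extend_shift[OF K(3) ux _ uv(1) kept[OF 3(1) a]] kept[OF 3(2) b] \<open>x \<noteq> v\<close> by auto
    qed
  qed
qed

lemma subcubic_proper_edge_coloring:
  assumes "finite E" "\<And>e. e \<in> E \<Longrightarrow> card e = 2" "\<And>w. degree E w \<le> 3" "card C = 4"
  shows "\<exists>c. proper_edge_coloring E C c"
  using assms
proof (induction E rule: finite_induct)
  case empty
  then show ?case by (simp add: proper_edge_coloring_def)
next
  case (insert e E)
  have fin: "finite (insert e E)" using insert by simp
  have deg: "degree E w \<le> 3" for w
    using degree_mono[OF fin subset_insertI] insert.prems(2) le_trans by blast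
  then obtain c where c: "proper_edge_coloring E C c" using insert by blast
  obtain u v where uv: "e = {u, v}" "u \<noteq> v" using insert.prems(1)[of e] by (auto simp: card_2_iff)
  have "degree E w \<le> 2" if "w \<in> e" for w
    using degree_remove[OF fin, of e w] insert.prems(2)[of w] insert.hyps(2) that by simp
  have "card f = 2" if "f \<in> E" for f using insert.prems(1) that by simp
  with deg show ?case
    using extend_subcubic_coloring[OF insert.hyps(1) _ insert.prems(3) c uv(2)]
      \<open>\<And>w. w \<in> e \<Longrightarrow> degree E w \<le> 2\<close> insert.hyps(2) unfolding uv(1) by simp
qed

section \<open>Splitting vertices\<close>

text \<open>The edges at \<open>v\<close> are numbered by \<open>h v\<close> and dealt out in blocks
  of three to copies \<open>(v, p)\<close> of \<open>v\<close>. A proper coloring uses each color at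
  most once per copy, and \<open>(degree E v + 2) div 3\<close> is the number of copies, the
  quotient by 3 rounded up.\<close>

lemma near_third_edge_coloring:
  assumes "finite E" "\<And>e. e \<in> E \<Longrightarrow> card e = 2" "card C = 4"
  obtains c where "c \<in> E \<rightarrow> C"
    "\<And>v i. card {e \<in> E. v \<in> e \<and> c e = i} \<le> (degree E v + 2) div 3"
proof -
  have "\<exists>h. bij_betw h {e \<in> E. v \<in> e} {0..<degree E v}" for v
    unfolding degree_def using assms(1) by (intro ex_bij_betw_finite_nat) auto
  then obtain h where h: "\<And>v. bij_betw (h v) {e \<in> E. v \<in> e} {0..<degree E v}" by metis
  define split where "split e = (\<lambda>v. (v, h v e div 3)) ` e" for e
  \<comment> \<open>Forgetting the copy indices recovers the edge, so distinct edges stay distinct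
    after splitting.\<close>
  have fst_split: "fst ` split e = e" for e by (force simp: split_def)
  have card2: "card (split e) = 2" if "e \<in> E" for e
    using assms(2)[OF that] unfolding split_def by (subst card_image) (auto simp: inj_on_def)
  have "degree (split ` E) (v, p) \<le> 3" for v p
  proof -
    let ?S = "{e \<in> E. v \<in> e \<and> h v e div 3 = p}"
    have "{s \<in> split ` E. (v, p) \<in> s} \<subseteq> split ` ?S" by (auto simp: split_def)
    then have "degree (split ` E) (v, p) \<le> card (split ` ?S)"
      unfolding degree_def using assms(1) by (intro card_mono) auto
    also have "\<dots> \<le> card ?S" using assms(1) by (intro card_image_le) auto
    also have "\<dots> = card (h v ` ?S)"
      using h[of v] by (intro card_image[symmetric]) (auto simp: bij_betw_def inj_on_def)
    also have "\<dots> \<le> card {3 * p, 3 * p + 1, 3 * p + 2}"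
    proof (intro card_mono subsetI)
      fix n assume "n \<in> h v ` ?S"
      then have "n div 3 = p" by auto
      then show "n \<in> {3 * p, 3 * p + 1, 3 * p + 2}" by auto
    qed simp
    also have "\<dots> = 3" by simp
    finally show ?thesis .
  qed
  then obtain c where c: "proper_edge_coloring (split ` E) C c"
    using subcubic_proper_edge_coloring[of "split ` E" C] assms(1,3) card2 by force
  show thesis
  proof (rule that)
    show "c \<circ> split \<in> E \<rightarrow> C" using c by (auto simp: proper_edge_coloring_def)
    fix v i
    let ?S = "{e \<in> E. v \<in> e \<and> (c \<circ> split) e = i}"
    \<comment> \<open>Edges at \<open>v\<close> of equal color must end in different copies of
      \<open>v\<close>.\<close>
    have "inj_on (\<lambda>e. h v e div 3) ?S"
    proof (rule inj_onI)
      fix e f assume ef: "e \<in> ?S" "f \<in> ?S" "h v e div 3 = h v f div 3"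
      then have "(v, h v e div 3) \<in> split e" "(v, h v e div 3) \<in> split f"
        by (auto simp: split_def)
      moreover have "split e \<in> split ` E" "split f \<in> split ` E" "c (split e) = c (split f)"
        using ef(1,2) by auto
      ultimately have "split e = split f"
        using c ef(3) unfolding proper_edge_coloring_def by metis
      then show "e = f" using fst_split by metis
    qed
    moreover have "(\<lambda>e. h v e div 3) ` ?S \<subseteq> {..<(degree E v + 2) div 3}"
    proof (rule image_subsetI)
      fix e assume "e \<in> ?S"
      then have "h v e < degree E v" using bij_betwE[OF h[of v]] by simp
      then show "h v e div 3 \<in> {..<(degree E v + 2) div 3}" unfolding lessThan_iff by linarith
    qed
    ultimately show "card ?S \<le> (degree E v + 2) div 3"
      using card_inj_on_le[of _ ?S "{..<(degree E v + 2) div 3}"] by simp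
  qed
qed

theorem theorem4:
  fixes V :: "'a set" and E :: "'a set set"
  assumes "finite_simple_graph V E"
    and "\<forall>v\<in>V. degree E v \<noteq> 2 \<and> degree E v \<noteq> 4"
  shows "Maj' E \<le> 4 \<and>
    (\<exists>c :: 'a set \<Rightarrow> nat. strong_majority_edge_coloring E {1..4} c)"
proof -
  have card2: "\<And>e. e \<in> E \<Longrightarrow> card e = 2" and EV: "\<And>e. e \<in> E \<Longrightarrow> e \<subseteq> V"
    using assms(1) by (auto simp: finite_simple_graph_def)
  then have "E \<subseteq> Pow V" by blast
  then have fin: "finite E" using assms(1) finite_subset by (auto simp: finite_simple_graph_def)
  obtain c :: "'a set \<Rightarrow> nat" where c: "c \<in> E \<rightarrow> {1..4}"
    "\<And>v i. card {e \<in> E. v \<in> e \<and> c e = i} \<le> (degree E v + 2) div 3"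
    by (rule near_third_edge_coloring[OF fin card2, of "{1..4 :: nat}"]) simp_all
  \<comment> \<open>Leaving out \<open>e\<close> matters for degree 1, where the rounded third is 1
    but no other edge remains. For degree 3 and all degrees from 5 on, the rounded third is small
    enough by itself.\<close>
  have at_end: "2 * card {f \<in> E. w \<in> f \<and> f \<noteq> e \<and> c f = i} + 1 \<le> degree E w"
    if e: "e \<in> E" "w \<in> e" for e w i
  proof -
    let ?S = "{f \<in> E. w \<in> f \<and> f \<noteq> e \<and> c f = i}"
    have "card ?S \<le> card {f \<in> E. w \<in> f \<and> c f = i}" using fin by (intro card_mono) auto
    then have third: "card ?S \<le> (degree E w + 2) div 3" using c(2) le_trans by blast
    have "card (insert e ?S) \<le> degree E w"
      unfolding degree_def using fin e by (intro card_mono) auto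
    then have "card ?S + 1 \<le> degree E w" using fin by simp
    moreover have "degree E w \<noteq> 2" "degree E w \<noteq> 4" using assms(2) EV e by auto
    ultimately show ?thesis using third by presburger
  qed
  have "strong_majority_edge_coloring E {1..4} c"
    unfolding strong_majority_edge_coloring_def
  proof (intro conjI allI impI ballI c(1))
    fix u v i assume uv: "{u, v} \<in> E" and "i \<in> {1..4 :: nat}"
    let ?A = "\<lambda>w. {f \<in> E. w \<in> f \<and> f \<noteq> {u, v} \<and> c f = i}"
    have "u \<noteq> v" using card2[OF uv] by auto
    have "{f \<in> E. card ({u, v} \<inter> f) = 1 \<and> c f = i} \<subseteq> ?A u \<union> ?A v"
    proof clarsimp
      fix f assume "card ({u, v} \<inter> f) = Suc 0" "v \<in> f \<longrightarrow> f = {u, v}"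
      then show "u \<in> f \<and> f \<noteq> {u, v}" using \<open>u \<noteq> v\<close> by (cases "u \<in> f"; cases "v \<in> f") auto
    qed
    then have "card {f \<in> E. card ({u, v} \<inter> f) = 1 \<and> c f = i} \<le> card (?A u \<union> ?A v)"
      using fin by (intro card_mono) auto
    also have "\<dots> \<le> card (?A u) + card (?A v)" by (rule card_Un_le)
    \<comment> \<open>The spare 1 at each end gives the 2 that becomes the required -1 after
      halving.\<close>
    finally have "2 * card {f \<in> E. card ({u, v} \<inter> f) = 1 \<and> c f = i} + 2 \<le> degree E u + degree E v"
      using at_end[OF uv, of u i] at_end[OF uv, of v i] by simp
    then have "real (2 * card {f \<in> E. card ({u, v} \<inter> f) = 1 \<and> c f = i} + 2)
        \<le> real (degree E u + degree E v)"
      unfolding of_nat_le_iff .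
    then show "real (card {f \<in> E. card ({u, v} \<inter> f) = 1 \<and> c f = i})
        \<le> (real (degree E u) + real (degree E v)) / 2 - 1"
      by (simp add: field_simps)
  qed
  then have ex: "\<exists>c :: 'a set \<Rightarrow> nat. strong_majority_edge_coloring E {1..4} c" by blast
  then have "Maj' E \<le> enat 4" unfolding Maj'_def by (intro INF_lower CollectI)
  with ex show ?thesis by (simp add: numeral_eq_enat)
qed

end
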